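(* Let $(X,d_X,\leq_{P_1})$ and $(Y,d_Y,\leq_{P_2})$ be two partially ordered complete metric spaces and let $F:X\times Y\rightarrow X$, $G:Y\times X\rightarrow Y$ be two mappings (not assumed continuous) having the mixed monotone property. Assume that $X$ and $Y$ have the following properties: (i) if a non-decreasing sequence $\{x_j\}$ in $X$ converges to $x\in X$, then $x_j\leq_{P_1} x$ for all $j$; (ii) if a non-increasing sequence $\{y_j\}$ in $Y$ converges to $y\in Y$, then $y\leq_{P_2} y_j$ for all $j$. Also assume that there exist non-negative real numbers $a,b,c$ with $2b+c<1$ and $2a+c<1$ satisfying $$d_X(F(x,y),F(u,v))\leq a\, d_X(x,F(u,v))+ b\, d_X(u, F(x,y))+c\, d_X(x,u)\quad \text{for all } x,u\in X,\ y,v\in Y \text{ with } x\geq_{P_1}u,\ y\leq_{P_2}v,$$ $$d_Y(G(y,x),G(v,u))\leq a\, d_Y(y,G(v,u))+ b\, d_Y(v,G(y,x))+c\, d_Y(y,v)\quad \text{for all } x,u\in X,\ y,v\in Y \text{ with } x\leq_{P_1}u,\ y\geq_{P_2}v.$$ If there exist $x_0\in X$, $y_0\in Y$ satisfying $x_0\leq_{P_1} F(x_0, y_0)$ and $y_0\geq_{P_2} G(y_0, x_0)$, then there exist $x\in X$, $y\in Y$ such that $x=F(x,y)$ and $y=G(y,x)$.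
   Context: A partially ordered complete metric space $(X,d_X,\leq_{P_1})$ is a set $X$ with a metric $d_X$ for which it is complete and a partial order $\leq_{P_1}$ (no compatibility between them is assumed beyond what is stated). The maps $F:X\times Y\to X$ and $G:Y\times X\to Y$ have the mixed monotone property if for all $x\in X$, $y\in Y$: for all $x_1,x_2\in X$, $x_1\leq_{P_1} x_2$ implies $F(x_1,y)\leq_{P_1} F(x_2,y)$ and $G(y,x_1)\geq_{P_2}G(y,x_2)$; and for all $y_1,y_2\in Y$, $y_1\leq_{P_2}y_2$ implies $F(x,y_1)\geq_{P_1}F(x,y_2)$ and $G(y_1,x)\leq_{P_2}G(y_2,x)$. *)

theory Defs
  imports "HOL-Analysis.Analysis"
begin

text \<open>
  A partially ordered complete metric space is a type of sort
  \<open>{complete_space, order}\<close>: these two classes share no axiom, so the metric and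
  the order are unrelated.
\<close>

definition mixed_monotone ::
  "('a::order \<Rightarrow> 'b::order \<Rightarrow> 'a) \<Rightarrow> ('b \<Rightarrow> 'a \<Rightarrow> 'b) \<Rightarrow> bool" where
  "mixed_monotone F G \<longleftrightarrow>
    (\<forall>x y.
      (\<forall>x\<^sub>1 x\<^sub>2. x\<^sub>1 \<le> x\<^sub>2 \<longrightarrow> F x\<^sub>1 y \<le> F x\<^sub>2 y \<and> G y x\<^sub>1 \<ge> G y x\<^sub>2) \<and>
      (\<forall>y\<^sub>1 y\<^sub>2. y\<^sub>1 \<le> y\<^sub>2 \<longrightarrow> F x y\<^sub>1 \<ge> F x y\<^sub>2 \<and> G y\<^sub>1 x \<le> G y\<^sub>2 x))"

end

theory Submission
  imports Defs
begin

text \<open>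
  Iterate \<open>(x, y) \<mapsto> (F x y, G y x)\<close> from the given starting point: by mixed monotonicity the first
  components increase and the second ones decrease, so consecutive iterates are comparable and the
  contraction conditions apply to them. One of the two cross terms vanishes and the other is a
  two-step distance, so consecutive distances shrink geometrically with ratio \<open>(b + c) / (1 - b)\<close>
  in \<open>X\<close> and \<open>(a + c) / (1 - a)\<close> in \<open>Y\<close>. The order properties (i) and (ii) make the limits comparable
  with all iterates, so the contraction conditions apply once more and replace continuity.
\<close>

text \<open>The iterated triangle inequality bounds \<open>dist (s m) (s n)\<close> by a block of
  the series, which is small by the Cauchy criterion.\<close>

lemma summable_dist_imp_Cauchy:
  fixes s :: "nat \<Rightarrow> 'a::metric_space"
  assumes "summable (\<lambda>n. dist (s n) (s (Suc n)))"
  shows "Cauchy s"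
proof (rule CauchyI')
  fix e :: real assume "0 < e"
  with assms obtain N where
    N: "\<And>m n. m \<ge> N \<Longrightarrow> norm (\<Sum>k = m..<n. dist (s k) (s (Suc k))) < e"
    unfolding summable_Cauchy by blast
  have "dist (s m) (s n) \<le> (\<Sum>k = m..<n. dist (s k) (s (Suc k)))" if "m \<le> n" for m n
    using that
  proof (induction n rule: dec_induct)
    case (step n)
    then show ?case
      using dist_triangle[of "s m" "s (Suc n)" "s n"] by simp
  qed simp
  then have "dist (s m) (s n) < e" if "m \<ge> N" "m < n" for m n
    using N[OF \<open>m \<ge> N\<close>, of n] that by (smt (verit) less_imp_le real_norm_def)
  then show "\<exists>M. \<forall>m\<ge>M. \<forall>n>m. dist (s m) (s n) < e"
    by blast
qed

text \<open>The triangle inequality splits the two-step distance, and its second half is absorbed on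
  the left. The resulting ratio \<open>(p + c) / (1 - p)\<close> is below 1 exactly because
  \<open>2 * p + c < 1\<close>.\<close>

lemma Cauchy_two_step_contraction:
  fixes s :: "nat \<Rightarrow> 'a::metric_space"
  assumes "p \<ge> 0" "c \<ge> 0" "2 * p + c < 1"
    and contr: "\<And>n. dist (s (Suc n)) (s (Suc (Suc n)))
      \<le> p * dist (s n) (s (Suc (Suc n))) + c * dist (s n) (s (Suc n))"
  shows "Cauchy s"
proof -
  have "dist (s (Suc n)) (s (Suc (Suc n))) \<le> (p + c) / (1 - p) * dist (s n) (s (Suc n))" for n
  proof -
    have "p * dist (s n) (s (Suc (Suc n)))
        \<le> p * (dist (s n) (s (Suc n)) + dist (s (Suc n)) (s (Suc (Suc n))))"
      using \<open>p \<ge> 0\<close> by (intro mult_left_mono dist_triangle)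
    with contr[of n] show ?thesis
      using assms(1-3) by (simp add: field_simps)
  qed
  moreover have "(p + c) / (1 - p) < 1"
    using assms(1-3) by (simp add: field_simps)
  ultimately have "summable (\<lambda>n. dist (s n) (s (Suc n)))"
    by (intro summable_ratio_test[where N = 0 and c = "(p + c) / (1 - p)"]) auto
  then show ?thesis
    by (rule summable_dist_imp_Cauchy)
qed

text \<open>In the limit the \<open>q\<close> and \<open>c\<close> terms vanish, leaving
  \<open>dist l w \<le> p * dist l w\<close>. With \<open>w\<close> the image of the limit pair,
  this gives the fixed-point equation without continuity.\<close>

lemma tendsto_contraction_limit_eq:
  fixes s :: "nat \<Rightarrow> 'a::metric_space"
  assumes lim: "s \<longlonglongrightarrow> l" and "p < 1"
    and contr: "\<And>n. dist (s (Suc n)) w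
      \<le> p * dist (s n) w + q * dist l (s (Suc n)) + c * dist (s n) l"
  shows "w = l"
proof -
  have lim': "(\<lambda>n. s (Suc n)) \<longlonglongrightarrow> l"
    using lim by (rule LIMSEQ_Suc)
  have "dist l w \<le> p * dist l w + q * dist l l + c * dist l l"
  proof (rule LIMSEQ_le)
    show "(\<lambda>n. dist (s (Suc n)) w) \<longlonglongrightarrow> dist l w"
      by (intro tendsto_intros lim')
    show "(\<lambda>n. p * dist (s n) w + q * dist l (s (Suc n)) + c * dist (s n) l)
        \<longlonglongrightarrow> p * dist l w + q * dist l l + c * dist l l"
      by (intro tendsto_intros lim lim')
  qed (use contr in blast)
  then have "(1 - p) * dist l w \<le> 0"
    by (simp add: algebra_simps)
  with \<open>p < 1\<close> have "dist l w \<le> 0"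
    by (simp add: mult_le_0_iff)
  then show ?thesis
    by simp
qed

theorem theorem2p11:
  fixes F :: "'a::{complete_space, order} \<Rightarrow> 'b::{complete_space, order} \<Rightarrow> 'a"
    and G :: "'b \<Rightarrow> 'a \<Rightarrow> 'b"
    and a b c :: real
  assumes mixed: "mixed_monotone F G"
    and incseq_le_lim: "\<And>(s :: nat \<Rightarrow> 'a) x. incseq s \<Longrightarrow> s \<longlonglongrightarrow> x \<Longrightarrow> (\<forall>j. s j \<le> x)"
    and decseq_ge_lim: "\<And>(t :: nat \<Rightarrow> 'b) y. decseq t \<Longrightarrow> t \<longlonglongrightarrow> y \<Longrightarrow> (\<forall>j. y \<le> t j)"
    and nonneg: "a \<ge> 0" "b \<ge> 0" "c \<ge> 0"
    and coeffs: "2 * b + c < 1" "2 * a + c < 1"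
    and contr_F: "\<And>x u y v. x \<ge> u \<Longrightarrow> y \<le> v \<Longrightarrow>
      dist (F x y) (F u v) \<le> a * dist x (F u v) + b * dist u (F x y) + c * dist x u"
    and contr_G: "\<And>x u y v. x \<le> u \<Longrightarrow> y \<ge> v \<Longrightarrow>
      dist (G y x) (G v u) \<le> a * dist y (G v u) + b * dist v (G y x) + c * dist y v"
    and start: "\<exists>x\<^sub>0 y\<^sub>0. x\<^sub>0 \<le> F x\<^sub>0 y\<^sub>0 \<and> y\<^sub>0 \<ge> G y\<^sub>0 x\<^sub>0"
  shows "\<exists>x y. x = F x y \<and> y = G y x"
proof -
  obtain x\<^sub>0 y\<^sub>0 where start: "x\<^sub>0 \<le> F x\<^sub>0 y\<^sub>0" "G y\<^sub>0 x\<^sub>0 \<le> y\<^sub>0"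
    using start by blast
  define z where "z n = ((\<lambda>(x, y). (F x y, G y x)) ^^ n) (x\<^sub>0, y\<^sub>0)" for n
  define s where "s n = fst (z n)" for n
  define t where "t n = snd (z n)" for n
  have s_Suc: "s (Suc n) = F (s n) (t n)" and t_Suc: "t (Suc n) = G (t n) (s n)" for n
    by (simp_all add: s_def t_def z_def case_prod_beta)

  \<comment> \<open>Change one argument at a time, passing through \<open>F x v\<close> and
    \<open>G v x\<close>.\<close>
  have F_mono: "F u v \<le> F x y" and G_mono: "G y x \<le> G v u" if "u \<le> x" "y \<le> v" for x u y v
    using mixed that unfolding mixed_monotone_def by (meson order_trans)+
  have step: "s n \<le> s (Suc n) \<and> t (Suc n) \<le> t n" for n
  proof (induction n)
    case 0
    with start show ?case
      by (simp add: s_def t_def z_def)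
  next
    case (Suc n)
    then show ?case
      using F_mono G_mono by (simp add: s_Suc t_Suc)
  qed
  then have "incseq s" and "decseq t"
    by (auto intro: incseq_SucI decseq_SucI)

  have "Cauchy s"
  proof (rule Cauchy_two_step_contraction)
    fix n
    show "dist (s (Suc n)) (s (Suc (Suc n)))
        \<le> b * dist (s n) (s (Suc (Suc n))) + c * dist (s n) (s (Suc n))"
      \<comment> \<open>The later iterate is the larger one and plays \<open>x\<close>, so the
        \<open>a\<close> term is \<open>dist (s (Suc n)) (s (Suc n)) = 0\<close>.\<close>
      using contr_F[of "s n" "s (Suc n)" "t (Suc n)" "t n"] step[of n]
      by (simp add: dist_commute flip: s_Suc)
  qed (use nonneg coeffs in auto)
  then obtain x where x: "s \<longlonglongrightarrow> x"
    using Cauchy_convergent convergent_def by blast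

  have "Cauchy t"
  proof (rule Cauchy_two_step_contraction)
    fix n
    show "dist (t (Suc n)) (t (Suc (Suc n)))
        \<le> a * dist (t n) (t (Suc (Suc n))) + c * dist (t n) (t (Suc n))"
      \<comment> \<open>Since \<open>t\<close> decreases, the earlier iterate now plays
        \<open>y\<close>; hence the \<open>b\<close> term vanishes instead.\<close>
      using contr_G[of "s n" "s (Suc n)" "t (Suc n)" "t n"] step[of n]
      by (simp flip: t_Suc)
  qed (use nonneg coeffs in auto)
  then obtain y where y: "t \<longlonglongrightarrow> y"
    using Cauchy_convergent convergent_def by blast

  have bounds: "s n \<le> x" "y \<le> t n" for n
    using incseq_le_lim[OF \<open>incseq s\<close> x] decseq_ge_lim[OF \<open>decseq t\<close> y] by auto
  have "F x y = x"
  proof (rule tendsto_contraction_limit_eq[OF x])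
    fix n
    show "dist (s (Suc n)) (F x y)
        \<le> b * dist (s n) (F x y) + a * dist x (s (Suc n)) + c * dist (s n) x"
      \<comment> \<open>The limit pair dominates and plays \<open>(x, y)\<close>, so the coefficient
        to be kept below 1 is \<open>b\<close>; for \<open>G\<close> below, \<open>t n\<close>
        dominates \<open>y\<close> and it is \<open>a\<close>.\<close>
      using contr_F[OF bounds, of n n] by (simp add: dist_commute flip: s_Suc)
  qed (use nonneg coeffs in auto)
  moreover have "G y x = y"
  proof (rule tendsto_contraction_limit_eq[OF y])
    fix n
    show "dist (t (Suc n)) (G y x)
        \<le> a * dist (t n) (G y x) + b * dist y (t (Suc n)) + c * dist (t n) y"
      using contr_G[OF bounds, of n n] by (simp flip: t_Suc)
  qed (use nonneg coeffs in auto)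
  ultimately show ?thesis
    by metis
qed

end
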